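(* Let $L=K_1\cup\dots\cup K_\mu$ and $L'=K'_1\cup\dots\cup K'_{\mu'}$ be (oriented, virtual) links with $M_A^{\mathrm{enr}}(L)\cong M_A^{\mathrm{enr}}(L')$. Then $\mu=\mu'$ and the linking numbers in $L$ are precisely the same as the linking numbers in $L'$, i.e. $\ell_{j/i}(K_i,K_j)=\ell_{j/i}(K'_i,K'_j)$ for all $i\neq j$ in $\{1,\dots,\mu\}$.
   Context: **Link diagrams.** A link diagram $D$ is an oriented virtual link diagram in $\mathbb R^2$: finitely many oriented, piecewise smooth closed curves $C_1,\dots,C_\mu$ with finitely many (self-)intersections, all transverse double points, each designated classical (with over/under information) or virtual. At each classical crossing the underpassing strand (only) is cut; nothing is cut at virtual crossings. The resulting pieces are the arcs; $A(D)$ is the set of arcs and $C(D)$ the set of classical crossings. $\kappa_D:A(D)\to\{1,\dots,\mu\}$ sends an arc to the index of the component containing it. Two diagrams are equivalent if related by a finite sequence of classical Reidemeister moves (involving only classical crossings) and detour moves (a segment of a curve $C_i$ with no classical crossing is replaced by any other piecewise smooth segment with the same endpoints and no classical crossing); all moves preserve orientations and component indices. A link $L=K_1\cup\dots\cup K_\mu$ is an equivalence class of diagrams, the component $K_i$ being represented by $C_i$. **Crossing data.** For $c\in C(D)$: $a(c)$ is the overpassing arc, $b_1(c)$ the underpassing arc on the right-hand side of the oriented arc $a(c)$, and $b_2(c)$ the underpassing arc on its left-hand side. The writhe $w(c)$ is $+1$ if the underpassing strand is oriented from $b_1(c)$ to $b_2(c)$, and $-1$ if it is oriented from $b_2(c)$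 to $b_1(c)$. **Reduced Alexander module.** $\Lambda=\mathbb Z[t,t^{-1}]$. $\Lambda^{A(D)},\Lambda^{C(D)}$ are the free $\Lambda$-modules on $A(D),C(D)$. $\varrho_D:\Lambda^{C(D)}\to\Lambda^{A(D)}$ is the $\Lambda$-linear map with $\varrho_D(c)=(1-t)a(c)+tb_1(c)-b_2(c)$. $M_A^{\mathrm{red}}(D)=\operatorname{coker}\varrho_D$, with quotient map $\varsigma_D:\Lambda^{A(D)}\to M_A^{\mathrm{red}}(D)$. **The map $\varphi_D$.** $\epsilon:\Lambda\to\mathbb Z$ is the ring homomorphism with $\epsilon(t^{\pm1})=1$, and $\mathbb Z_\epsilon$ is $\mathbb Z$ with the $\Lambda$-action $\lambda\cdot n=\epsilon(\lambda)n$. $\varphi_D:M_A^{\mathrm{red}}(D)\to\Lambda\oplus(\mathbb Z_\epsilon)^{\mu-1}$ is the $\Lambda$-linear map with $\varphi_D(\varsigma_D(a))=(1,0,\dots,0)$ if $\kappa_D(a)=1$, and $\varphi_D(\varsigma_D(a))=(1,0,\dots,0,1,0,\dots,0)$, with the second $1$ in the $i$th coordinate, if $\kappa_D(a)=i>1$. **Peripheral elements.** $M_i(D)$, the set of meridians of $K_i$, is the set of all $x\in M_A^{\mathrm{red}}(D)$ with $\varphi_D(x)=\varphi_D(\varsigma_D(a))$ for any arc $a$ with $\kappa_D(a)=i$. The longitude of $K_i$ is $$\chi_i(D)=\varsigma_D\Big(\sum_{c\in C(D),\,\kappa_D(b_1(c))=i}w(c)a(c)-\tfrac12\sum_{c\in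 C(D),\,\kappa_D(b_1(c))=i}w(c)(b_1(c)+b_2(c))\Big),$$ where the second sum has all coefficients in $\{-2,0,2\}$ (each arc occurs $0$ or $2$ times as an underpassing arc), so multiplication by $\frac12$ makes sense. **Enhanced module.** $M_A^{\mathrm{enr}}(D)=(M_A^{\mathrm{red}}(D),M_1(D),\dots,M_\mu(D),\chi_1(D),\dots,\chi_\mu(D))$. For $\mu$-component diagrams $D,D'$, an isomorphism $M_A^{\mathrm{enr}}(D)\to M_A^{\mathrm{enr}}(D')$ is a $\Lambda$-module isomorphism $f:M_A^{\mathrm{red}}(D)\to M_A^{\mathrm{red}}(D')$ with $f(M_i(D))=M_i(D')$ and $f(\chi_i(D))=\chi_i(D')$ for all $i$ (so isomorphisms are only defined between lists of the same length). Up to isomorphism $M_A^{\mathrm{enr}}(D)$ depends only on the link $L$ represented by $D$; $M_A^{\mathrm{enr}}(L)$ means $M_A^{\mathrm{enr}}(D)$ for any diagram $D$ of $L$. **Linking numbers.** For a diagram $D$ of $L$ and $i\ne j$, the linking number of $K_j$ over $K_i$ is $$\ell_{j/i}(K_i,K_j)=\ell_{j/i}(K_j,K_i)=\sum_{c\in C(D),\ \kappa_D(a(c))=j,\ \kappa_D(b_1(c))=i}w(c),$$ which is a link invariant; for virtual links $\ell_{j/i}$ and $\ell_{i/j}$ may differ. *)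

theory Defs
  imports "HOL-Analysis.Analysis" "HOL-Library.Poly_Mapping"
begin

section \<open>Oriented virtual link diagrams\<close>

text \<open>The plane is \<^typ>\<open>complex\<close>.  Component \<open>i\<close> (for \<open>1 \<le> i \<le> ncomp D\<close>) is a closed curve given as a
  1-periodic function of a real parameter, oriented by increasing parameter; its points are addressed
  by parameter points \<open>(i, s)\<close> with \<open>0 \<le> s < 1\<close>.  A classical crossing is the pair
  (overpassing parameter point, underpassing parameter point); the remaining double points are the
  virtual crossings.\<close>

type_synonym ppoint = "nat \<times> real"
type_synonym crossing = "ppoint \<times> ppoint"

record vdiagram =
  ncomp :: nat
  curve :: "nat \<Rightarrow> real \<Rightarrow> complex"
  classical :: "crossing set"

definition comps :: "vdiagram \<Rightarrow> nat set" where
  "comps D = {1..ncomp D}"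

definition ppoints :: "vdiagram \<Rightarrow> ppoint set" where
  "ppoints D = comps D \<times> {0..<1}"

definition pos :: "vdiagram \<Rightarrow> ppoint \<Rightarrow> complex" where
  "pos D p = curve D (fst p) (snd p)"

definition velocity :: "vdiagram \<Rightarrow> ppoint \<Rightarrow> complex" where
  "velocity D p = vector_derivative (curve D (fst p)) (at (snd p))"

text \<open>\<open>cross u v\<close> is the determinant of the real 2x2 matrix with columns \<open>u\<close>, \<open>v\<close>; it is positive iff
  \<open>v\<close> points to the left-hand side of \<open>u\<close>.\<close>

definition cross :: "complex \<Rightarrow> complex \<Rightarrow> real" where
  "cross u v = Im (cnj u * v)"

definition double_points :: "vdiagram \<Rightarrow> crossing set" where
  "double_points D = {(p, q). p \<in> ppoints D \<and> q \<in> ppoints D \<and> p \<noteq> q \<and> pos D p = pos D q}"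

definition smooth_near :: "(real \<Rightarrow> complex) \<Rightarrow> real \<Rightarrow> bool" where
  "smooth_near g s \<longleftrightarrow> (\<exists>e>0. g C1_differentiable_on {s - e<..<s + e})"

text \<open>Double points lie away from the corners of the curves, so that transversality can be expressed by the
  velocities.\<close>

definition virtual_diagram :: "vdiagram \<Rightarrow> bool" where
  "virtual_diagram D \<longleftrightarrow>
     ncomp D \<ge> 1 \<and>
     (\<forall>i\<in>comps D. (\<forall>s. curve D i (s + 1) = curve D i s) \<and>
                   curve D i piecewise_C1_differentiable_on {0..1}) \<and>
     finite (double_points D) \<and>
     (\<forall>p q r. (p, q) \<in> double_points D \<and> (p, r) \<in> double_points D \<longrightarrow> q = r) \<and>
     (\<forall>(p, q)\<in>double_points D. smooth_near (curve D (fst p)) (snd p) \<and>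
                                cross (velocity D p) (velocity D q) \<noteq> 0) \<and>
     classical D \<subseteq> double_points D \<and>
     (\<forall>p q. (p, q) \<in> classical D \<longrightarrow> (q, p) \<notin> classical D)"


section \<open>Equivalence of diagrams\<close>

definition orientation_preserving_diffeo :: "(complex \<Rightarrow> complex) \<Rightarrow> bool" where
  "orientation_preserving_diffeo h \<longleftrightarrow>
     bij h \<and>
     (\<exists>h'. (\<forall>z. (h has_derivative h' z) (at z)) \<and>
           (\<forall>v. continuous_on UNIV (\<lambda>z. h' z v)) \<and>
           (\<forall>z. cross (h' z 1) (h' z \<i>) > 0))"

definition circle_reparam :: "(real \<Rightarrow> real) \<Rightarrow> bool" where
  "circle_reparam r \<longleftrightarrow>
     (\<forall>s. r (s + 1) = r s + 1) \<and>
     (\<exists>r'. continuous_on UNIV r' \<and> (\<forall>s. (r has_real_derivative r' s) (at s) \<and> r' s > 0))"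

text \<open>Diagrams are considered up to planar isotopy and choice of the parametrizations; every orientation
  preserving diffeomorphism of the plane is isotopic to the identity.\<close>

definition planar_isotopy :: "vdiagram \<Rightarrow> vdiagram \<Rightarrow> bool" where
  "planar_isotopy D D' \<longleftrightarrow>
     ncomp D = ncomp D' \<and>
     (\<exists>h r. orientation_preserving_diffeo h \<and>
        (\<forall>i\<in>comps D. circle_reparam (r i) \<and> (\<forall>s. curve D' i s = h (curve D i (r i s)))) \<and>
        (\<forall>(i, s)\<in>ppoints D. \<forall>(j, t)\<in>ppoints D.
           ((i, s), (j, t)) \<in> classical D' \<longleftrightarrow>
           ((i, frac (r i s)), (j, frac (r j t))) \<in> classical D))"

definition detour_move :: "vdiagram \<Rightarrow> vdiagram \<Rightarrow> bool" where
  "detour_move D D' \<longleftrightarrow>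
     ncomp D = ncomp D' \<and> classical D = classical D' \<and>
     (\<exists>i\<in>comps D. \<exists>s t. s < t \<and> t < s + 1 \<and>
        (\<forall>x\<in>{s..t}. (i, frac x) \<notin> Domain (classical D) \<union> Range (classical D)) \<and>
        (\<forall>x\<in>{t..s + 1}. curve D' i x = curve D i x) \<and>
        (\<forall>j\<in>comps D - {i}. \<forall>x. curve D' j x = curve D j x))"

text \<open>A Reidemeister move takes place inside the image of the closed unit disc under an orientation
  preserving diffeomorphism \<open>h\<close>.  The part of the diagram in that disc consists of \<open>n\<close> strands: strand
  \<open>k < n\<close> runs along the \<open>h\<close>-image of the model curve \<open>m k\<close> on \<open>[-1, 1]\<close> and, if \<open>\<sigma> k = (i, c, d)\<close>, is the
  piece of component \<open>i\<close> with parameters \<open>c + d * x\<close>, \<open>x \<in> [-1, 1]\<close>, where a negative \<open>d\<close> reverses the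
  direction of the model.  Model crossings are pairs ((over strand, \<open>x\<close>), (under strand, \<open>y\<close>)).\<close>

type_synonym placement = "nat \<Rightarrow> nat \<times> real \<times> real"

definition place :: "placement \<Rightarrow> nat \<times> real \<Rightarrow> ppoint" where
  "place \<sigma> = (\<lambda>(k, x). case \<sigma> k of (i, c, d) \<Rightarrow> (i, frac (c + d * x)))"

definition strand_points :: "nat \<Rightarrow> placement \<Rightarrow> ppoint set" where
  "strand_points n \<sigma> = place \<sigma> ` ({..<n} \<times> {-1..1})"

definition local_picture ::
  "nat \<Rightarrow> placement \<Rightarrow> (complex \<Rightarrow> complex) \<Rightarrow> (nat \<Rightarrow> real \<Rightarrow> complex) \<Rightarrow> crossing set \<Rightarrow> vdiagram \<Rightarrow> bool"
where
  "local_picture n \<sigma> h m X D \<longleftrightarrow>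
     (\<forall>k<n. case \<sigma> k of (i, c, d) \<Rightarrow> i \<in> comps D \<and> d \<noteq> 0) \<and>
     inj_on (place \<sigma>) ({..<n} \<times> {-1..1}) \<and>
     (\<forall>k<n. \<forall>x\<in>{-1..1}. pos D (place \<sigma> (k, x)) = h (m k x)) \<and>
     (\<forall>p\<in>ppoints D. pos D p \<in> h ` cball 0 1 \<longrightarrow> p \<in> strand_points n \<sigma>) \<and>
     classical D \<inter> (strand_points n \<sigma> \<times> strand_points n \<sigma>) = map_prod (place \<sigma>) (place \<sigma>) ` X"

definition local_move ::
  "nat \<Rightarrow> (nat \<Rightarrow> real \<Rightarrow> complex) \<Rightarrow> crossing set \<Rightarrow> (nat \<Rightarrow> real \<Rightarrow> complex) \<Rightarrow> crossing set
     \<Rightarrow> vdiagram \<Rightarrow> vdiagram \<Rightarrow> bool"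
where
  "local_move n m X m' X' D D' \<longleftrightarrow>
     ncomp D = ncomp D' \<and>
     (\<exists>h \<sigma>. orientation_preserving_diffeo h \<and>
        local_picture n \<sigma> h m X D \<and> local_picture n \<sigma> h m' X' D' \<and>
        (\<forall>p\<in>ppoints D - strand_points n \<sigma>. pos D p = pos D' p) \<and>
        classical D - (strand_points n \<sigma> \<times> strand_points n \<sigma>) = classical D' - (strand_points n \<sigma> \<times> strand_points n \<sigma>))"

text \<open>First move: a diameter is replaced by a nodal cubic with node at the parameters \<open>-1/2\<close>, \<open>1/2\<close>.  Both
  sides of the strand for the loop arise from the two directions of the strand.\<close>

definition reidemeister1 :: "vdiagram \<Rightarrow> vdiagram \<Rightarrow> bool" where
  "reidemeister1 D D' \<longleftrightarrow>
     (\<exists>X. (X = {((0, 1/2), (0, -1/2))} \<or> X = {((0, -1/2), (0, 1/2))}) \<and>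
        local_move 1 (\<lambda>k x. Complex x 0) {}
          (\<lambda>k x. Complex ((4 * x^3 - x) / 3) ((1 - x^2) / 2)) X D D')"

text \<open>Second move: strand 1 is pushed across the diameter (strand 0), entirely above or entirely below it.\<close>

definition reidemeister2 :: "vdiagram \<Rightarrow> vdiagram \<Rightarrow> bool" where
  "reidemeister2 D D' \<longleftrightarrow>
     (\<exists>X. (X = {((0, 2/5), (1, 1/2)), ((0, -2/5), (1, -1/2))} \<or>
           X = {((1, 1/2), (0, 2/5)), ((1, -1/2), (0, -2/5))}) \<and>
        local_move 2
          (\<lambda>k x. if k = 0 then Complex x 0 else Complex (4 * x / 5) (-3/5)) {}
          (\<lambda>k x. if k = 0 then Complex x 0 else Complex (4 * x / 5) ((1 - 4 * x^2) / 5)) X D D')"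

text \<open>Third move: strand 0 is pushed across the crossing of the diameters 1 and 2; the injective function
  \<open>ht\<close> gives the heights of the three strands.\<close>

definition r3_strands :: "real \<Rightarrow> nat \<Rightarrow> real \<Rightarrow> complex" where
  "r3_strands e k x =
     (if k = 0 then Complex x (e * (1 - x^2) / 2)
      else if k = 1 then Complex (3 * x / 5) (4 * x / 5)
      else Complex (-3 * x / 5) (4 * x / 5))"

definition r3_crossings :: "real \<Rightarrow> (nat \<Rightarrow> nat) \<Rightarrow> crossing set" where
  "r3_crossings e ht =
     (let X = {((0, e/3), (1, e * 5/9)), ((0, -e/3), (2, e * 5/9)), ((1, 0), (2, 0))}
      in {(p, q). (p, q) \<in> X \<union> X\<inverse> \<and> ht (fst p) > ht (fst q)})"

definition reidemeister3 :: "vdiagram \<Rightarrow> vdiagram \<Rightarrow> bool" where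
  "reidemeister3 D D' \<longleftrightarrow>
     (\<exists>ht. inj_on ht {..<3} \<and>
        local_move 3 (r3_strands (-1)) (r3_crossings (-1) ht) (r3_strands 1) (r3_crossings 1 ht) D D')"

definition diagram_move :: "vdiagram \<Rightarrow> vdiagram \<Rightarrow> bool" where
  "diagram_move D D' \<longleftrightarrow>
     virtual_diagram D \<and> virtual_diagram D' \<and>
     (planar_isotopy D D' \<or> detour_move D D' \<or>
      reidemeister1 D D' \<or> reidemeister2 D D' \<or> reidemeister3 D D')"

definition diagram_equiv :: "(vdiagram \<times> vdiagram) set" where
  "diagram_equiv =
     {(D, D'). virtual_diagram D \<and> virtual_diagram D' \<and> equivclp diagram_move D D'}"

definition virtual_links :: "vdiagram set set" where
  "virtual_links = {D. virtual_diagram D} // diagram_equiv"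


section \<open>Arcs and crossing data\<close>

text \<open>The parameter circle of a component is the unit circle.  An arc is a component index together with
  a connected component of the parameter circle cut at the underpassing parameters.\<close>

type_synonym arc = "nat \<times> complex set"

definition circ :: "real \<Rightarrow> complex" where
  "circ s = cis (2 * pi * s)"

definition cut_circle :: "vdiagram \<Rightarrow> nat \<Rightarrow> complex set" where
  "cut_circle D i = sphere 0 1 - circ ` {s. (i, s) \<in> Range (classical D)}"

definition arcs :: "vdiagram \<Rightarrow> arc set" where
  "arcs D = (SIGMA i : comps D. components (cut_circle D i))"

abbreviation (input) arc_comp :: "arc \<Rightarrow> nat"  (\<open>\<kappa>\<close>) where
  "\<kappa> \<equiv> fst"

definition over_arc :: "vdiagram \<Rightarrow> crossing \<Rightarrow> arc" where
  "over_arc D c = (THE A. A \<in> arcs D \<and> \<kappa> A = fst (fst c) \<and> circ (snd (fst c)) \<in> snd A)"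

definition in_arc :: "vdiagram \<Rightarrow> crossing \<Rightarrow> arc" where
  "in_arc D c = (THE A. A \<in> arcs D \<and> \<kappa> A = fst (snd c) \<and>
                    (\<forall>\<^sub>F s in at_left (snd (snd c)). circ s \<in> snd A))"

definition out_arc :: "vdiagram \<Rightarrow> crossing \<Rightarrow> arc" where
  "out_arc D c = (THE A. A \<in> arcs D \<and> \<kappa> A = fst (snd c) \<and>
                    (\<forall>\<^sub>F s in at_right (snd (snd c)). circ s \<in> snd A))"

definition right_to_left :: "vdiagram \<Rightarrow> crossing \<Rightarrow> bool" where
  "right_to_left D c \<longleftrightarrow> cross (velocity D (fst c)) (velocity D (snd c)) > 0"

text \<open>\<open>under_arc1\<close> and \<open>under_arc2\<close> are the underpassing arcs on the right-hand and on the left-hand side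
  of the overpassing arc, respectively.\<close>

definition under_arc1 :: "vdiagram \<Rightarrow> crossing \<Rightarrow> arc" where
  "under_arc1 D c = (if right_to_left D c then in_arc D c else out_arc D c)"

definition under_arc2 :: "vdiagram \<Rightarrow> crossing \<Rightarrow> arc" where
  "under_arc2 D c = (if right_to_left D c then out_arc D c else in_arc D c)"

definition writhe :: "vdiagram \<Rightarrow> crossing \<Rightarrow> int" where
  "writhe D c = (if right_to_left D c then 1 else -1)"

text \<open>\<open>linking_number D j i\<close> is the linking number of component \<open>j\<close> over component \<open>i\<close>.\<close>

definition linking_number :: "vdiagram \<Rightarrow> nat \<Rightarrow> nat \<Rightarrow> int" where
  "linking_number D j i =
     (\<Sum>c\<in>{c \<in> classical D. \<kappa> (over_arc D c) = j \<and> \<kappa> (under_arc1 D c) = i}. writhe D c)"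


section \<open>The reduced Alexander module\<close>

text \<open>Laurent polynomials over the integers as the group ring of the infinite cyclic group: the
  multiplication of \<^typ>\<open>int \<Rightarrow>\<^sub>0 int\<close> is convolution.\<close>

type_synonym laurent = "int \<Rightarrow>\<^sub>0 int"

definition lt :: laurent where
  "lt = Poly_Mapping.single 1 1"

definition augmentation :: "laurent \<Rightarrow> int" where
  "augmentation l = (\<Sum>k\<in>Poly_Mapping.keys l. Poly_Mapping.lookup l k)"

definition smul :: "laurent \<Rightarrow> ('x \<Rightarrow>\<^sub>0 laurent) \<Rightarrow> ('x \<Rightarrow>\<^sub>0 laurent)" where
  "smul l x = Poly_Mapping.map (\<lambda>y. l * y) x"

definition gen :: "'x \<Rightarrow> ('x \<Rightarrow>\<^sub>0 laurent)" where
  "gen a = Poly_Mapping.single a 1"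

definition free_module :: "'x set \<Rightarrow> ('x \<Rightarrow>\<^sub>0 laurent) set" where
  "free_module S = {x. Poly_Mapping.keys x \<subseteq> S}"

definition rho :: "vdiagram \<Rightarrow> (crossing \<Rightarrow>\<^sub>0 laurent) \<Rightarrow> (arc \<Rightarrow>\<^sub>0 laurent)" where
  "rho D y = (\<Sum>c\<in>Poly_Mapping.keys y. smul (Poly_Mapping.lookup y c)
     (smul (1 - lt) (gen (over_arc D c)) + smul lt (gen (under_arc1 D c)) - gen (under_arc2 D c)))"

definition relations :: "vdiagram \<Rightarrow> (arc \<Rightarrow>\<^sub>0 laurent) set" where
  "relations D = rho D ` free_module (classical D)"

text \<open>Elements of the cokernel are cosets of the image of \<^const>\<open>rho\<close>.\<close>

type_synonym alex = "(arc \<Rightarrow>\<^sub>0 laurent) set"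

definition quot :: "vdiagram \<Rightarrow> (arc \<Rightarrow>\<^sub>0 laurent) \<Rightarrow> alex" where
  "quot D x = (\<lambda>r. x + r) ` relations D"

definition alex_carrier :: "vdiagram \<Rightarrow> alex set" where
  "alex_carrier D = quot D ` free_module (arcs D)"

definition alex_add :: "alex \<Rightarrow> alex \<Rightarrow> alex" where
  "alex_add X Y = {x + y |x y. x \<in> X \<and> y \<in> Y}"

definition alex_smul :: "vdiagram \<Rightarrow> laurent \<Rightarrow> alex \<Rightarrow> alex" where
  "alex_smul D l X = {smul l x + r |x r. x \<in> X \<and> r \<in> relations D}"


section \<open>Meridians, longitudes and the enhanced module\<close>

text \<open>The direct sum of the ring of Laurent polynomials and \<open>\<mu> - 1\<close> copies of the augmentation module is
  rendered by \<^typ>\<open>laurent \<times> (nat \<Rightarrow>\<^sub>0 int)\<close>; the first component is coordinate 1, and the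
  second one holds the coordinates \<open>2, \<dots>, \<mu>\<close>.\<close>

type_synonym target = "laurent \<times> (nat \<Rightarrow>\<^sub>0 int)"

definition target_smul :: "laurent \<Rightarrow> target \<Rightarrow> target" where
  "target_smul l v = (l * fst v, Poly_Mapping.map (\<lambda>n. augmentation l * n) (snd v))"

definition comp_value :: "nat \<Rightarrow> target" where
  "comp_value i = (1, if i = 1 then 0 else Poly_Mapping.single i 1)"

definition phi_free :: "vdiagram \<Rightarrow> (arc \<Rightarrow>\<^sub>0 laurent) \<Rightarrow> target" where
  "phi_free D x =
     (\<Sum>a\<in>Poly_Mapping.keys x. target_smul (Poly_Mapping.lookup x a) (comp_value (\<kappa> a)))"

text \<open>\<^const>\<open>phi_free\<close> vanishes on the relations, so it is constant on cosets.\<close>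

definition phi :: "vdiagram \<Rightarrow> alex \<Rightarrow> target" where
  "phi D X = the_elem (phi_free D ` X)"

definition meridian_set :: "vdiagram \<Rightarrow> nat \<Rightarrow> alex set" where
  "meridian_set D i =
     {X \<in> alex_carrier D. \<forall>a\<in>arcs D. \<kappa> a = i \<longrightarrow> phi D X = phi D (quot D (gen a))}"

definition half :: "(arc \<Rightarrow>\<^sub>0 laurent) \<Rightarrow> (arc \<Rightarrow>\<^sub>0 laurent)" where
  "half s = (THE h. h + h = s)"

definition longitude :: "vdiagram \<Rightarrow> nat \<Rightarrow> alex" where
  "longitude D i =
     (let C = {c \<in> classical D. \<kappa> (under_arc1 D c) = i} in
      quot D ((\<Sum>c\<in>C. smul (of_int (writhe D c)) (gen (over_arc D c)))
        - half (\<Sum>c\<in>C. smul (of_int (writhe D c)) (gen (under_arc1 D c) + gen (under_arc2 D c)))))"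

record 'm enhanced_module =
  carr :: "'m set"
  add_m :: "'m \<Rightarrow> 'm \<Rightarrow> 'm"
  smul_m :: "laurent \<Rightarrow> 'm \<Rightarrow> 'm"
  meridians :: "'m set list"
  longitudes :: "'m list"

definition M_enr :: "vdiagram \<Rightarrow> alex enhanced_module" where
  "M_enr D =
     \<lparr>carr = alex_carrier D, add_m = alex_add, smul_m = alex_smul D,
      meridians = map (meridian_set D) [1..<Suc (ncomp D)],
      longitudes = map (longitude D) [1..<Suc (ncomp D)]\<rparr>"

definition enhanced_iso ::
  "('m \<Rightarrow> 'n) \<Rightarrow> 'm enhanced_module \<Rightarrow> 'n enhanced_module \<Rightarrow> bool" where
  "enhanced_iso f E E' \<longleftrightarrow>
     bij_betw f (carr E) (carr E') \<and>
     (\<forall>x\<in>carr E. \<forall>y\<in>carr E. f (add_m E x y) = add_m E' (f x) (f y)) \<and>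
     (\<forall>l. \<forall>x\<in>carr E. f (smul_m E l x) = smul_m E' l (f x)) \<and>
     map ((`) f) (meridians E) = meridians E' \<and>
     map f (longitudes E) = longitudes E'"

definition enhanced_isomorphic :: "'m enhanced_module \<Rightarrow> 'n enhanced_module \<Rightarrow> bool"
    (infix \<open>\<cong>\<^sub>e\<^sub>n\<^sub>r\<close> 50) where
  "E \<cong>\<^sub>e\<^sub>n\<^sub>r E' \<longleftrightarrow> (\<exists>f. enhanced_iso f E E')"

end

theory Submission
  imports Defs
begin

text \<open>An isomorphism of enhanced modules sends meridians of \<open>K\<^sub>i\<close> to meridians of \<open>K'\<^sub>i\<close>.  Since the arcs
  generate the module, it commutes with the maps \<open>\<phi>\<close>, hence the longitudes of both links have the same
  \<open>\<phi>\<close>-values.  For \<open>j \<noteq> 1, i\<close> the \<open>j\<close>th coordinate of \<open>\<phi>(\<chi>\<^sub>i)\<close> is \<open>\<ell>\<^sub>j\<^sub>/\<^sub>i\<close>, and for \<open>i \<noteq> 1\<close> its \<open>i\<close>th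
  coordinate is \<open>- \<Sum>\<^sub>j\<^sub>\<noteq>\<^sub>i \<ell>\<^sub>j\<^sub>/\<^sub>i\<close>; so the coordinates \<open>2, \<dots>, \<mu>\<close> add up to \<open>- \<ell>\<^sub>1\<^sub>/\<^sub>i\<close>.\<close>

section \<open>The arcs of the parameter circle\<close>

lemma circ_eq_iff: "circ s = circ t \<longleftrightarrow> (\<exists>n::int. s = t + of_int n)"
proof -
  have "circ s = circ t \<longleftrightarrow> (\<exists>n::int. 2 * pi * s = 2 * pi * t + 2 * pi * of_int n)"
    unfolding circ_def using sin_cos_eq_iff[of "2 * pi * s" "2 * pi * t"]
    by (auto simp: complex_eq_iff)
  also have "\<dots> \<longleftrightarrow> (\<exists>n::int. s = t + of_int n)"
    by (simp flip: distrib_left)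
  finally show ?thesis .
qed

lemma circ_add_of_int [simp]: "circ (s + of_int n) = circ s"
  by (auto simp: circ_eq_iff)

lemma circ_add_one [simp]: "circ (s + 1) = circ s"
  using circ_add_of_int[of s 1] by simp

lemma continuous_on_circ: "continuous_on S circ"
  unfolding circ_def by (intro continuous_intros)

lemma norm_circ [simp]: "norm (circ s) = 1"
  by (simp add: circ_def)

text \<open>Both half-open windows occur later: the cut point following \<open>p\<close> is sought
  in \<open>{p<..p + 1}\<close>, the preceding one in \<open>{p - 1..<p}\<close>.\<close>

lemma inj_on_circ_Ico: "inj_on circ {a..<a + 1}"
  and inj_on_circ_Ioc: "inj_on circ {a<..a + 1}"
proof -
  have "n = 0" if "s = t + of_int n" "\<bar>s - t\<bar> < 1" for s t :: real and n :: int
    using that by linarith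
  then show "inj_on circ {a..<a + 1}" "inj_on circ {a<..a + 1}"
    by (fastforce simp: inj_on_def circ_eq_iff)+
qed

lemma sphere_eq_circ_image: "sphere 0 1 = circ ` {a..a + 1}"
proof
  show "sphere 0 1 \<subseteq> circ ` {a..a + 1}"
  proof
    fix z :: complex assume "z \<in> sphere 0 1"
    then have "norm z = 1" "z \<noteq> 0" by auto
    then have "z = cis (Arg z)" by (simp add: cis_Arg sgn_eq)
    then have z: "z = circ (Arg z / (2 * pi))" by (simp add: circ_def)
    define s where "s = Arg z / (2 * pi)"
    \<comment> \<open>An integer shift moves \<open>s\<close> into the window that starts at
      \<open>a\<close>.\<close>
    have "circ s = circ (a + frac (s - a))"
      by (auto simp: circ_eq_iff frac_def intro!: exI[of _ "\<lfloor>s - a\<rfloor>"])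
    moreover have "a + frac (s - a) \<in> {a..a + 1}"
      using frac_lt_1[of "s - a"] by simp
    moreover have "z = circ s" unfolding s_def by (fact z)
    ultimately show "z \<in> circ ` {a..a + 1}" by simp
  qed
qed auto

text \<open>Endpoints are taken on the real line covering the circle and have to be cut points only
  modulo 1. So arcs through the base point need no special treatment, and a single cut point gives a
  gap of length 1.\<close>

definition gap :: "real set \<Rightarrow> real \<Rightarrow> real \<Rightarrow> bool" where
  "gap P a b \<longleftrightarrow> a < b \<and> circ a \<in> circ ` P \<and> circ b \<in> circ ` P \<and>
     (\<forall>s\<in>{a<..<b}. circ s \<notin> circ ` P)"

text \<open>Modulo 1 the point \<open>a + 1\<close> is again the cut point \<open>a\<close>, so it
  cannot lie inside the gap.\<close>

lemma gap_length: "gap P a b \<Longrightarrow> b \<le> a + 1"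
  unfolding gap_def by (metis circ_add_one greaterThanLessThan_iff less_add_one not_less)

lemma gap_translate: "gap P a b \<Longrightarrow> gap P (a + of_int n) (b + of_int n)"
proof -
  assume g: "gap P a b"
  have "circ s \<notin> circ ` P" if "s \<in> {a + of_int n<..<b + of_int n}" for s
  proof -
    have "s + of_int (- n) \<in> {a<..<b}" using that by auto
    then have "circ (s + of_int (- n)) \<notin> circ ` P" using g unfolding gap_def by blast
    then show ?thesis unfolding circ_add_of_int .
  qed
  then show ?thesis using g by (simp add: gap_def)
qed

text \<open>Once the first gap is translated, both intervals contain \<open>x'\<close>. If their
  ends differed, an end of one would be a cut point inside the other. Hence an arc determines its
  gap up to an integer translation.\<close>

lemma gap_overlap:
  assumes "gap P a b" "gap P a' b'" "x \<in> {a<..<b}" "x' \<in> {a'<..<b'}" "circ x = circ x'"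
  obtains n :: int where "a' = a + of_int n" "b' = b + of_int n"
proof -
  obtain n :: int where n: "x' = x + of_int n" using assms(5) circ_eq_iff[of x' x] by auto
  have g: "gap P (a + of_int n) (b + of_int n)" using gap_translate assms(1) by blast
  have x: "x' \<in> {a + of_int n<..<b + of_int n}" using n assms(3) by auto
  have "a' \<le> a + of_int n \<and> b + of_int n \<le> b'"
    using g assms(2) x assms(4) unfolding gap_def by (meson greaterThanLessThan_iff less_trans not_le)
  moreover have "a + of_int n \<le> a' \<and> b' \<le> b + of_int n"
    using g assms(2) x assms(4) unfolding gap_def by (meson greaterThanLessThan_iff less_trans not_le)
  ultimately show ?thesis using that[of n] by linarith
qed

lemma gap_right:
  assumes "finite P" "p \<in> P"
  obtains q where "gap P p q"
proof -
  let ?Q = "{q \<in> {p<..p + 1}. circ q \<in> circ ` P}"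
  have "finite (circ ` ?Q)" using assms by (auto intro: finite_subset[of _ "circ ` P"])
  moreover have "inj_on circ ?Q" by (rule inj_on_subset[OF inj_on_circ_Ioc[of p]]) auto
  ultimately have fin: "finite ?Q" by (simp add: finite_image_iff)
  have ne: "p + 1 \<in> ?Q" using assms by simp
  obtain m where m: "m \<in> ?Q" and le: "\<And>s. s \<in> ?Q \<Longrightarrow> m \<le> s"
    using Min_in[OF fin] Min_le[OF fin] ne by blast
  have "\<forall>s\<in>{p<..<m}. circ s \<notin> circ ` P"
    using m le by force
  then have "gap P p m" using m assms(2) by (simp add: gap_def)
  then show ?thesis by (rule that)
qed

lemma gap_left:
  assumes "finite P" "p \<in> P"
  obtains q where "gap P q p"
proof -
  let ?Q = "{q \<in> {p - 1..<p}. circ q \<in> circ ` P}"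
  have "finite (circ ` ?Q)" using assms by (auto intro: finite_subset[of _ "circ ` P"])
  moreover have "inj_on circ ?Q" by (rule inj_on_subset[OF inj_on_circ_Ico[of "p - 1"]]) auto
  ultimately have fin: "finite ?Q" by (simp add: finite_image_iff)
  have "circ (p - 1) = circ p" using circ_add_one[of "p - 1"] by simp
  then have ne: "p - 1 \<in> ?Q" using assms by simp
  obtain m where m: "m \<in> ?Q" and le: "\<And>s. s \<in> ?Q \<Longrightarrow> s \<le> m"
    using Max_in[OF fin] Max_ge[OF fin] ne by blast
  have "\<forall>s\<in>{m<..<p}. circ s \<notin> circ ` P"
  proof
    fix s assume s: "s \<in> {m<..<p}"
    then have "s \<notin> ?Q" using le[of s] by auto
    then show "circ s \<notin> circ ` P" using s m by simp
  qed
  then have "gap P m p" using m assms(2) by (simp add: gap_def)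
  then show ?thesis by (rule that)
qed

text \<open>The open arc is connected, so it lies in some component \<open>C\<close>. The closed
  arcs over \<open>{a..b}\<close> and \<open>{b..a + 1}\<close> cover the circle and meet only in
  the removed points \<open>circ a\<close> and \<open>circ b\<close>, so the connected set
  \<open>C\<close> stays in the first of them.\<close>

lemma gap_component:
  assumes g: "gap P a b"
  shows "circ ` {a<..<b} \<in> components (sphere 0 1 - circ ` P)"
proof -
  let ?I = "circ ` {a<..<b}" and ?S = "sphere 0 1 - circ ` P"
  have ab: "a < b" "b \<le> a + 1" "circ a \<notin> ?S" "circ b \<notin> ?S"
    using g gap_length[OF g] by (auto simp: gap_def)
  have conn: "connected ?I"
    by (intro connected_continuous_image continuous_on_circ) simp
  have sub: "?I \<subseteq> ?S" using g by (auto simp: gap_def)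
  have ne: "?I \<noteq> {}" using ab by simp
  obtain C where C: "C \<in> components ?S" "?I \<subseteq> C"
    using exists_component_superset[OF sub _ conn] sub ne by blast
  have CS: "C \<subseteq> ?S" using C in_components_subset by blast
  have Cab: "circ a \<notin> C" "circ b \<notin> C" using CS ab(3,4) by (meson subsetD)+
  have closed: "closed (circ ` {a..b})" "closed (circ ` {b..a + 1})"
    by (intro compact_imp_closed compact_continuous_image continuous_on_circ compact_Icc)+
  have "{a..a + 1} = {a..b} \<union> {b..a + 1}" using ab by auto
  then have cover: "C \<subseteq> circ ` {a..b} \<union> circ ` {b..a + 1}"
    using CS sphere_eq_circ_image[of a] by (metis Diff_subset image_Un order_trans)
  have "circ ` {a..b} \<inter> circ ` {b..a + 1} \<subseteq> {circ a, circ b}"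
  proof
    fix z assume "z \<in> circ ` {a..b} \<inter> circ ` {b..a + 1}"
    then obtain s t where z: "z = circ t" and st: "circ s = circ t" "a \<le> s" "s \<le> b" "b \<le> t" "t \<le> a + 1"
      by auto
    then obtain n :: int where n: "t = s + of_int n" using circ_eq_iff[of t s] by auto
    \<comment> \<open>The two parameter intervals touch at \<open>b\<close> (no shift) and at the
      ends \<open>a\<close> and \<open>a + 1\<close> (shift by 1).\<close>
    have "n = 0 \<or> n = 1" using n st ab by linarith
    then have "t = b \<or> s = a" using n st by auto
    then show "z \<in> {circ a, circ b}" using z st(1) by auto
  qed
  from Int_mono[OF this order_refl[of C]] have "circ ` {a..b} \<inter> circ ` {b..a + 1} \<inter> C = {}"
    using Cab by simp
  moreover have "?I \<subseteq> circ ` {a..b} \<inter> C" using C(2)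
    by (simp add: image_mono greaterThanLessThan_subseteq_atLeastAtMost_iff)
  then have "circ ` {a..b} \<inter> C \<noteq> {}" using ne by (metis subset_empty)
  moreover have "connected C" using C in_components_connected by blast
  ultimately have "circ ` {b..a + 1} \<inter> C = {}"
    using connected_closedD[of C "circ ` {a..b}" "circ ` {b..a + 1}"] closed cover
    by (metis Int_commute)
  then have "C \<subseteq> circ ` {a..b}" using cover by blast
  moreover have "{a..b} = insert a (insert b {a<..<b})" using ab by auto
  ultimately have "C \<subseteq> insert (circ a) (insert (circ b) ?I)" by simp
  then have "C \<subseteq> ?I" using Cab by (simp add: subset_insert)
  then show ?thesis using C by auto
qed

section \<open>Crossings of a diagram and the arcs adjacent to them\<close>

definition under_params :: "vdiagram \<Rightarrow> nat \<Rightarrow> real set" where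
  "under_params D i = {s. (i, s) \<in> Range (classical D)}"

locale diagram =
  fixes D :: vdiagram
  assumes virtual_diagram: "virtual_diagram D"
begin

lemma finite_double_points: "finite (double_points D)"
  and double_point_unique: "(p, q) \<in> double_points D \<Longrightarrow> (p, r) \<in> double_points D \<Longrightarrow> q = r"
  and classical_subset: "classical D \<subseteq> double_points D"
  and classical_asym: "(p, q) \<in> classical D \<Longrightarrow> (q, p) \<notin> classical D"
  and ncomp_pos: "ncomp D \<ge> 1"
  using virtual_diagram unfolding virtual_diagram_def by blast+

lemma double_points_sym: "(p, q) \<in> double_points D \<Longrightarrow> (q, p) \<in> double_points D"
  by (auto simp: double_points_def)

lemma finite_classical: "finite (classical D)"
  using finite_subset[OF classical_subset finite_double_points] .

lemma classical_ppoints: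
  "c \<in> classical D \<Longrightarrow> fst c \<in> ppoints D" "c \<in> classical D \<Longrightarrow> snd c \<in> ppoints D"
  using classical_subset by (auto simp: double_points_def)

text \<open>There are no triple points: the underpassing parameter point has a unique partner, which
  is the overpassing one.\<close>

lemma inj_on_snd_classical: "inj_on snd (classical D)"
proof (rule inj_onI)
  fix c c' assume c: "c \<in> classical D" "c' \<in> classical D" and eq: "snd c = snd c'"
  have "(snd d, fst d) \<in> double_points D" if "d \<in> classical D" for d
    by (rule double_points_sym) (use that classical_subset in auto)
  from this[OF c(1)] this[OF c(2)] have "fst c = fst c'"
    unfolding eq by (rule double_point_unique)
  then show "c = c'" using eq by (simp add: prod_eq_iff)
qed

text \<open>If the overpassing point were also an underpassing one, uniqueness of the partner would
  make the crossing classical in both orders, against asymmetry. This keeps overpassing points on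
  uncut parts of the circle.\<close>

lemma over_not_under:
  assumes c: "c \<in> classical D"
  shows "fst c \<notin> Range (classical D)"
proof
  assume "fst c \<in> Range (classical D)"
  then obtain p where p: "(p, fst c) \<in> classical D" by blast
  have "(fst c, p) \<in> double_points D" using p classical_subset double_points_sym by blast
  moreover have "(fst c, snd c) \<in> double_points D" using c classical_subset by auto
  ultimately have "p = snd c" by (rule double_point_unique)
  then show False using p c classical_asym[of "fst c" "snd c"] by simp
qed

lemma finite_under_params: "finite (under_params D i)"
proof -
  have "under_params D i \<subseteq> snd ` Range (classical D)" by (force simp: under_params_def)
  then show ?thesis using finite_classical by (meson finite_Range finite_imageI finite_subset)
qed

lemma under_params_subset: "under_params D i \<subseteq> {0..<1}"
  using classical_ppoints by (fastforce simp: under_params_def ppoints_def)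

lemma cut_circle_eq: "cut_circle D i = sphere 0 1 - circ ` under_params D i"
  by (simp add: cut_circle_def under_params_def)

text \<open>Removing finitely many points leaves infinitely many points of the circle; a component
  that never underpasses is included. Without an arc the condition defining
  \<open>meridian_set\<close> would be vacuous.\<close>

lemma ex_arc:
  assumes "i \<in> comps D"
  obtains A where "A \<in> arcs D" "fst A = i"
proof -
  have "infinite (circ ` {0..<1})"
    using inj_on_circ_Ico[of 0] by (simp add: finite_image_iff infinite_Ico)
  moreover have "circ ` {0..<1} \<subseteq> sphere 0 1" by auto
  ultimately have "infinite (cut_circle D i)"
    unfolding cut_circle_eq using finite_under_params infinite_super by (metis Diff_infinite_finite finite_imageI)
  then have "components (cut_circle D i) \<noteq> {}" by (metis components_eq_empty finite.emptyI)
  then obtain C where "C \<in> components (cut_circle D i)" by blast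
  then show ?thesis using that[of "(i, C)"] assms by (auto simp: arcs_def)
qed

lemma arcs_eqI:
  assumes "A \<in> arcs D" "B \<in> arcs D" "fst A = fst B" "z \<in> snd A" "z \<in> snd B"
  shows "A = B"
proof -
  have "snd A = snd B"
    using assms components_eq[of "snd A" "cut_circle D (fst A)" "snd B"] by (auto simp: arcs_def)
  then show ?thesis using assms(3) by (simp add: prod_eq_iff)
qed

lemma over_arc_in_arcs:
  assumes c: "c \<in> classical D"
  shows "over_arc D c \<in> arcs D"
proof -
  let ?i = "fst (fst c)" and ?z = "circ (snd (fst c))"
  have s: "?i \<in> comps D" "snd (fst c) \<in> {0..<1}"
    using classical_ppoints(1)[OF c] by (auto simp: ppoints_def)
  have "snd (fst c) \<notin> under_params D ?i"
    using over_not_under[OF c] by (simp add: under_params_def)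
  \<comment> \<open>All parameters concerned lie in \<open>{0..<1}\<close>, where
    \<open>circ\<close> is injective, so distinct parameters stay distinct on the circle.\<close>
  then have "?z \<notin> circ ` under_params D ?i"
    using s under_params_subset[of ?i] inj_on_circ_Ico[of 0]
    by (metis add.left_neutral inj_on_image_mem_iff)
  then have "?z \<in> cut_circle D ?i" by (simp add: cut_circle_eq)
  then obtain C where C: "C \<in> components (cut_circle D ?i)" "?z \<in> C"
    by (metis UnionE Union_components)
  then have mem: "(?i, C) \<in> arcs D" using s by (simp add: arcs_def)
  have "\<exists>!A. A \<in> arcs D \<and> fst A = ?i \<and> ?z \<in> snd A"
  proof (rule ex1I)
    show "(?i, C) \<in> arcs D \<and> fst (?i, C) = ?i \<and> ?z \<in> snd (?i, C)" using mem C(2) by simp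
    show "A = (?i, C)" if "A \<in> arcs D \<and> fst A = ?i \<and> ?z \<in> snd A" for A
      by (rule arcs_eqI[OF _ mem]) (use that C(2) in auto)
  qed
  from theI'[OF this] show "over_arc D c \<in> arcs D"
    unfolding over_arc_def by blast
qed

lemma gap_arc: "i \<in> comps D \<Longrightarrow> gap (under_params D i) a b \<Longrightarrow> (i, circ ` {a<..<b}) \<in> arcs D"
  using gap_component by (simp add: arcs_def cut_circle_eq)

text \<open>Parameters slightly above the underpass lie in the gap. Any other candidate for the
  definite description also contains such parameters, and two arcs of a component sharing a point
  coincide.\<close>

lemma out_arc_eq:
  assumes c: "c \<in> classical D" and g: "gap (under_params D (fst (snd c))) (snd (snd c)) b"
  shows "out_arc D c = (fst (snd c), circ ` {snd (snd c)<..<b})"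
  unfolding out_arc_def
proof (rule the_equality)
  let ?s = "snd (snd c)" and ?i = "fst (snd c)"
  have i: "?i \<in> comps D" using classical_ppoints(2)[OF c] by (auto simp: ppoints_def)
  have "?s < b" using g by (simp add: gap_def)
  then have ev: "\<forall>\<^sub>F s in at_right ?s. circ s \<in> circ ` {?s<..<b}"
    by (auto simp: eventually_at_right)
  then show *: "(?i, circ ` {?s<..<b}) \<in> arcs D \<and> fst (?i, circ ` {?s<..<b}) = ?i \<and>
      (\<forall>\<^sub>F s in at_right ?s. circ s \<in> snd (?i, circ ` {?s<..<b}))"
    using gap_arc[OF i g] by simp
  fix A assume A: "A \<in> arcs D \<and> fst A = ?i \<and> (\<forall>\<^sub>F s in at_right ?s. circ s \<in> snd A)"
  then have "\<forall>\<^sub>F s in at_right ?s. circ s \<in> snd A \<and> circ s \<in> circ ` {?s<..<b}"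
    using ev by (auto intro: eventually_conj)
  then obtain s where "circ s \<in> snd A" "circ s \<in> circ ` {?s<..<b}"
    using eventually_happens'[OF trivial_limit_at_right_real] by blast
  then show "A = (?i, circ ` {?s<..<b})" using A * arcs_eqI[of A "(?i, circ ` {?s<..<b})" "circ s"] by simp
qed

lemma in_arc_eq:
  assumes c: "c \<in> classical D" and g: "gap (under_params D (fst (snd c))) a (snd (snd c))"
  shows "in_arc D c = (fst (snd c), circ ` {a<..<snd (snd c)})"
  unfolding in_arc_def
proof (rule the_equality)
  let ?s = "snd (snd c)" and ?i = "fst (snd c)"
  have i: "?i \<in> comps D" using classical_ppoints(2)[OF c] by (auto simp: ppoints_def)
  have "a < ?s" using g by (simp add: gap_def)
  then have ev: "\<forall>\<^sub>F s in at_left ?s. circ s \<in> circ ` {a<..<?s}"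
    by (auto simp: eventually_at_left)
  then show *: "(?i, circ ` {a<..<?s}) \<in> arcs D \<and> fst (?i, circ ` {a<..<?s}) = ?i \<and>
      (\<forall>\<^sub>F s in at_left ?s. circ s \<in> snd (?i, circ ` {a<..<?s}))"
    using gap_arc[OF i g] by simp
  fix A assume A: "A \<in> arcs D \<and> fst A = ?i \<and> (\<forall>\<^sub>F s in at_left ?s. circ s \<in> snd A)"
  then have "\<forall>\<^sub>F s in at_left ?s. circ s \<in> snd A \<and> circ s \<in> circ ` {a<..<?s}"
    using ev by (auto intro: eventually_conj)
  then obtain s where "circ s \<in> snd A" "circ s \<in> circ ` {a<..<?s}"
    using eventually_happens'[OF trivial_limit_at_left_real] by blast
  then show "A = (?i, circ ` {a<..<?s})" using A * arcs_eqI[of A "(?i, circ ` {a<..<?s})" "circ s"] by simp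
qed

lemma under_param_mem: "c \<in> classical D \<Longrightarrow> snd (snd c) \<in> under_params D (fst (snd c))"
  by (cases c) (auto simp: under_params_def)

lemma gap_after:
  assumes "c \<in> classical D"
  obtains b where "gap (under_params D (fst (snd c))) (snd (snd c)) b"
    "out_arc D c = (fst (snd c), circ ` {snd (snd c)<..<b})"
  using gap_right[OF finite_under_params under_param_mem[OF assms]] out_arc_eq[OF assms] by metis

lemma gap_before:
  assumes "c \<in> classical D"
  obtains a where "gap (under_params D (fst (snd c))) a (snd (snd c))"
    "in_arc D c = (fst (snd c), circ ` {a<..<snd (snd c)})"
  using gap_left[OF finite_under_params under_param_mem[OF assms]] in_arc_eq[OF assms] by metis

lemma out_arc:
  assumes "c \<in> classical D"
  shows out_arc_in_arcs: "out_arc D c \<in> arcs D" and fst_out_arc: "fst (out_arc D c) = fst (snd c)"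
  using gap_after[OF assms] gap_arc classical_ppoints(2)[OF assms]
  by (metis mem_Times_iff ppoints_def, metis fst_conv)

lemma in_arc:
  assumes "c \<in> classical D"
  shows in_arc_in_arcs: "in_arc D c \<in> arcs D" and fst_in_arc: "fst (in_arc D c) = fst (snd c)"
  using gap_before[OF assms] gap_arc classical_ppoints(2)[OF assms]
  by (metis mem_Times_iff ppoints_def, metis fst_conv)

text \<open>This removes the integer ambiguity left by \<open>gap_overlap\<close>: both parameters
  lie in \<open>{0..<1}\<close>, so \<open>n = 0\<close>.\<close>

lemma classical_eqI:
  assumes "c \<in> classical D" "c' \<in> classical D" "fst (snd c) = fst (snd c')"
    and n: "snd (snd c') = snd (snd c) + of_int n"
  shows "c = c'"
proof -
  have "snd (snd c) \<in> {0..<1}" "snd (snd c') \<in> {0..<1}"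
    using assms under_param_mem under_params_subset by blast+
  then have "n = 0" using n by simp
  then have "snd c = snd c'" using assms by (simp add: prod_eq_iff)
  then show ?thesis using inj_on_snd_classical assms(1,2) by (meson inj_onD)
qed

text \<open>The arc determines its gap modulo 1, hence its starting parameter, hence the
  crossing.\<close>

lemma inj_on_out_arc: "inj_on (out_arc D) (classical D)"
proof (rule inj_onI)
  fix c c' assume c: "c \<in> classical D" "c' \<in> classical D" and eq: "out_arc D c = out_arc D c'"
  obtain b where b: "gap (under_params D (fst (snd c))) (snd (snd c)) b"
    "out_arc D c = (fst (snd c), circ ` {snd (snd c)<..<b})" using gap_after[OF c(1)] .
  obtain b' where b': "gap (under_params D (fst (snd c'))) (snd (snd c')) b'"
    "out_arc D c' = (fst (snd c'), circ ` {snd (snd c')<..<b'})" using gap_after[OF c(2)] .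
  obtain x where x: "x \<in> {snd (snd c)<..<b}" using b(1) dense unfolding gap_def by (metis greaterThanLessThan_iff)
  have eqs: "fst (snd c) = fst (snd c')" "circ ` {snd (snd c)<..<b} = circ ` {snd (snd c')<..<b'}"
    using eq b b' by auto
  then obtain x' where x': "x' \<in> {snd (snd c')<..<b'}" "circ x = circ x'" using x by blast
  obtain n :: int where "snd (snd c') = snd (snd c) + of_int n"
    using gap_overlap[OF b(1) b'(1)[folded eqs(1)] x x'] .
  then show "c = c'" using classical_eqI c eqs(1) by blast
qed

lemma inj_on_in_arc: "inj_on (in_arc D) (classical D)"
proof (rule inj_onI)
  fix c c' assume c: "c \<in> classical D" "c' \<in> classical D" and eq: "in_arc D c = in_arc D c'"
  obtain b where b: "gap (under_params D (fst (snd c))) b (snd (snd c))"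
    "in_arc D c = (fst (snd c), circ ` {b<..<snd (snd c)})" using gap_before[OF c(1)] .
  obtain b' where b': "gap (under_params D (fst (snd c'))) b' (snd (snd c'))"
    "in_arc D c' = (fst (snd c'), circ ` {b'<..<snd (snd c')})" using gap_before[OF c(2)] .
  obtain x where x: "x \<in> {b<..<snd (snd c)}" using b(1) dense unfolding gap_def by (metis greaterThanLessThan_iff)
  have eqs: "fst (snd c) = fst (snd c')" "circ ` {b<..<snd (snd c)} = circ ` {b'<..<snd (snd c')}"
    using eq b b' by auto
  then obtain x' where x': "x' \<in> {b'<..<snd (snd c')}" "circ x = circ x'" using x by blast
  obtain n :: int where "snd (snd c') = snd (snd c) + of_int n"
    using gap_overlap[OF b(1) b'(1)[folded eqs(1)] x x'] .
  then show "c = c'" using classical_eqI c eqs(1) by blast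
qed

section \<open>Outgoing and incoming arcs at the underpasses of one component\<close>

definition under_crossings :: "nat \<Rightarrow> crossing set" where
  "under_crossings i = {c \<in> classical D. fst (snd c) = i}"

lemma finite_under_crossings: "finite (under_crossings i)"
  using finite_classical by (simp add: under_crossings_def)

text \<open>An arc that leaves an underpass runs to the next underpass of the same component and
  enters it. This gives one inclusion; both images have the cardinality of
  \<open>under_crossings i\<close>, so equality follows by counting.\<close>

lemma out_arc_image_eq: "out_arc D ` under_crossings i = in_arc D ` under_crossings i"
proof (rule card_subset_eq)
  have "card (out_arc D ` under_crossings i) = card (under_crossings i)"
    by (intro card_image inj_on_subset[OF inj_on_out_arc]) (auto simp: under_crossings_def)
  moreover have "card (in_arc D ` under_crossings i) = card (under_crossings i)"
    by (intro card_image inj_on_subset[OF inj_on_in_arc]) (auto simp: under_crossings_def)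
  ultimately show "card (out_arc D ` under_crossings i) = card (in_arc D ` under_crossings i)" by simp
  show "finite (in_arc D ` under_crossings i)" using finite_under_crossings by blast
  show "out_arc D ` under_crossings i \<subseteq> in_arc D ` under_crossings i"
  proof
    fix A assume "A \<in> out_arc D ` under_crossings i"
    then obtain c where c: "c \<in> classical D" "fst (snd c) = i" "A = out_arc D c"
      by (auto simp: under_crossings_def)
    obtain b where b: "gap (under_params D i) (snd (snd c)) b"
      "out_arc D c = (i, circ ` {snd (snd c)<..<b})" using gap_after[OF c(1)] c(2) by metis
    then obtain q where q: "q \<in> under_params D i" "circ b = circ q" by (auto simp: gap_def)
    then obtain c' where c': "c' \<in> classical D" "snd c' = (i, q)"
      by (auto simp: under_params_def)
    obtain n :: int where n: "q = b + of_int n" using q circ_eq_iff[of q b] by auto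
    \<comment> \<open>The gap may end beyond 1, while the parameter \<open>q\<close> of the crossing
      \<open>c'\<close> is normalized, so the gap is translated to end at \<open>q\<close>.\<close>
    have "gap (under_params D i) (snd (snd c) + of_int n) q" using gap_translate[OF b(1)] n by blast
    then have "in_arc D c' = (i, circ ` {snd (snd c) + of_int n<..<q})"
      using in_arc_eq[OF c'(1)] c'(2) by (metis fst_conv snd_conv)
    moreover have "circ ` {snd (snd c) + of_int n<..<q} = circ ` {snd (snd c)<..<b}"
    proof -
      have "{snd (snd c) + of_int n<..<q} = (\<lambda>x. x + of_int n) ` {snd (snd c)<..<b}"
        using n by (auto simp: image_iff intro!: bexI[of _ "_ - of_int n"])
      then show ?thesis by (simp add: image_image)
    qed
    ultimately have "A = in_arc D c'" using b c by simp
    then show "A \<in> in_arc D ` under_crossings i" using c' by (auto simp: under_crossings_def)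
  qed
qed

end


section \<open>Linear extension and the map \<open>\<phi>\<close>\<close>

lemma lookup_smul [simp]: "Poly_Mapping.lookup (smul l x) k = l * Poly_Mapping.lookup x k"
  by (simp add: smul_def map.rep_eq when_def)

lemma keys_smul_subset: "Poly_Mapping.keys (smul l x) \<subseteq> Poly_Mapping.keys x"
  by (auto simp: in_keys_iff)

text \<open>This makes the library of subspaces and module homomorphisms available for free modules;
  relations and elements supported on arcs are then treated as subspaces.\<close>

interpretation free: module "smul :: laurent \<Rightarrow> ('x \<Rightarrow>\<^sub>0 laurent) \<Rightarrow> ('x \<Rightarrow>\<^sub>0 laurent)"
  by standard (auto intro!: poly_mapping_eqI simp: lookup_add algebra_simps)

lemma sum_single: "(\<Sum>k\<in>Poly_Mapping.keys x. Poly_Mapping.single k (Poly_Mapping.lookup x k)) = x"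
  by (rule poly_mapping_eqI) (auto simp: lookup_sum lookup_single when_def in_keys_iff)

section \<open>The augmentation homomorphism\<close>

lemma augmentation_zero [simp]: "augmentation 0 = 0"
  by (simp add: augmentation_def)

lemma augmentation_single [simp]: "augmentation (Poly_Mapping.single k n) = n"
  by (simp add: augmentation_def)

lemma augmentation_one [simp]: "augmentation 1 = 1"
  by (metis augmentation_single single_one)

lemma augmentation_lt [simp]: "augmentation lt = 1"
  by (simp add: lt_def)

lemma augmentation_add [simp]: "augmentation (l + m) = augmentation l + augmentation m"
  unfolding augmentation_def by (rule setsum_keys_plus_distrib) auto

lemma augmentation_diff [simp]: "augmentation (l - m) = augmentation l - augmentation m"
  using augmentation_add[of "l - m" m] by simp

lemma augmentation_sum: "augmentation (sum f S) = (\<Sum>k\<in>S. augmentation (f k))"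
  by (induction S rule: infinite_finite_induct) auto

lemma augmentation_of_int [simp]: "augmentation (of_int n) = n"
  by (metis augmentation_single of_int_eq_id id_apply single_of_int)

text \<open>On monomials convolution adds exponents, which the augmentation ignores, and multiplies
  coefficients; the general case follows by expanding both factors.\<close>

lemma augmentation_mult [simp]: "augmentation (l * m) = augmentation l * augmentation m"
proof -
  have "augmentation (l * m) = augmentation
     ((\<Sum>k\<in>Poly_Mapping.keys l. Poly_Mapping.single k (Poly_Mapping.lookup l k)) *
      (\<Sum>k\<in>Poly_Mapping.keys m. Poly_Mapping.single k (Poly_Mapping.lookup m k)))"
    by (simp add: sum_single)
  also have "\<dots> = augmentation l * augmentation m"
    unfolding sum_product augmentation_sum mult_single augmentation_single
    by (simp add: augmentation_def sum_product)
  finally show ?thesis .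
qed

lemma lookup_snd_target_smul:
  "Poly_Mapping.lookup (snd (target_smul l v)) k = augmentation l * Poly_Mapping.lookup (snd v) k"
  by (simp add: target_smul_def map.rep_eq when_def)

lemma fst_target_smul: "fst (target_smul l v) = l * fst v"
  by (simp add: target_smul_def)

interpretation target: module target_smul
  by standard
    (auto intro!: prod_eqI poly_mapping_eqI
      simp: lookup_snd_target_smul fst_target_smul lookup_add algebra_simps)

text \<open>Stated for an arbitrary module so that it serves both \<open>phi_free\<close> and
  \<open>rho\<close>.\<close>

lemma (in module) linear_extension_add:
  fixes x y :: "'k \<Rightarrow>\<^sub>0 'a"
  shows "(\<Sum>k\<in>Poly_Mapping.keys (x + y). scale (Poly_Mapping.lookup (x + y) k) (g k)) =
     (\<Sum>k\<in>Poly_Mapping.keys x. scale (Poly_Mapping.lookup x k) (g k)) +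
     (\<Sum>k\<in>Poly_Mapping.keys y. scale (Poly_Mapping.lookup y k) (g k))"
  by (rule setsum_keys_plus_distrib) (auto simp: scale_left_distrib)

text \<open>The scaled element enters as a \<open>z\<close> given by its coefficients, because
  \<open>smul\<close> is tied to \<open>laurent\<close> while the ring here is arbitrary. Scaling
  may annihilate coefficients, so the support of \<open>z\<close> can be smaller.\<close>

lemma (in module) linear_extension_scale:
  fixes x :: "'k \<Rightarrow>\<^sub>0 'a"
  assumes z: "\<And>k. Poly_Mapping.lookup z k = l * Poly_Mapping.lookup x k"
  shows "(\<Sum>k\<in>Poly_Mapping.keys z. scale (Poly_Mapping.lookup z k) (g k)) =
     scale l (\<Sum>k\<in>Poly_Mapping.keys x. scale (Poly_Mapping.lookup x k) (g k))"
proof -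
  have "Poly_Mapping.keys z \<subseteq> Poly_Mapping.keys x" by (auto simp: in_keys_iff z)
  then have "(\<Sum>k\<in>Poly_Mapping.keys z. scale (Poly_Mapping.lookup z k) (g k)) =
      (\<Sum>k\<in>Poly_Mapping.keys x. scale (Poly_Mapping.lookup z k) (g k))"
    by (intro sum.mono_neutral_left) (auto simp: in_keys_iff)
  also have "\<dots> = scale l (\<Sum>k\<in>Poly_Mapping.keys x. scale (Poly_Mapping.lookup x k) (g k))"
    by (simp add: z scale_sum_right)
  finally show ?thesis .
qed

interpretation phi: module_hom smul target_smul "phi_free D"
  by standard (simp_all only: phi_free_def target.linear_extension_add target.linear_extension_scale[OF lookup_smul])

interpretation rho: module_hom smul smul "rho D"
  by standard (simp_all only: rho_def free.linear_extension_add free.linear_extension_scale[OF lookup_smul])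

lemma phi_free_gen [simp]: "phi_free D (gen a) = comp_value (fst a)"
  by (simp add: phi_free_def gen_def)

section \<open>Submodules, halves and cosets\<close>

lemma free_module_subspace: "free.subspace (free_module S)"
  unfolding free.subspace_def free_module_def
  by (auto dest!: subsetD[OF keys_smul_subset] subsetD[OF keys_add])

lemma relations_subspace: "free.subspace (relations D)"
  unfolding relations_def by (intro rho.subspace_image free_module_subspace)

lemma gen_in_free_module: "a \<in> S \<Longrightarrow> gen a \<in> free_module S"
  by (simp add: free_module_def gen_def)

lemma free_module_expansion:
  fixes x :: "'a \<Rightarrow>\<^sub>0 laurent"
  shows "x = (\<Sum>a\<in>Poly_Mapping.keys x. smul (Poly_Mapping.lookup x a) (gen a))"
proof -
  have "smul l (gen a) = Poly_Mapping.single a l" for a :: 'a and l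
    by (rule poly_mapping_eqI) (simp add: gen_def lookup_single when_def)
  then show ?thesis by (simp add: sum_single)
qed

text \<open>The coefficients are integers in the end, so there is no 2-torsion and the description
  in \<open>half\<close> has at most one solution.\<close>

lemma half_unique:
  fixes x y :: "arc \<Rightarrow>\<^sub>0 laurent"
  assumes "x + x = y + y"
  shows "x = y"
proof (intro poly_mapping_eqI)
  fix a k
  have "Poly_Mapping.lookup (Poly_Mapping.lookup (x + x) a) k = Poly_Mapping.lookup (Poly_Mapping.lookup (y + y) a) k"
    using assms by simp
  then show "Poly_Mapping.lookup (Poly_Mapping.lookup x a) k = Poly_Mapping.lookup (Poly_Mapping.lookup y a) k"
    unfolding lookup_add by simp
qed

lemma half_eqI: "h + h = s \<Longrightarrow> half s = h"
  unfolding half_def by (rule the_equality) (auto intro: half_unique)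

lemma alex_add_quot: "alex_add (quot D x) (quot D y) = quot D (x + y)"
proof
  show "alex_add (quot D x) (quot D y) \<subseteq> quot D (x + y)"
    unfolding alex_add_def quot_def
    using free.subspace_add[OF relations_subspace[of D]] by (force simp: algebra_simps)
  show "quot D (x + y) \<subseteq> alex_add (quot D x) (quot D y)"
  proof
    fix z assume "z \<in> quot D (x + y)"
    \<comment> \<open>The whole relation goes to the second summand; the first uses the zero
      relation.\<close>
    then obtain r where r: "r \<in> relations D" "z = (x + 0) + (y + r)"
      by (auto simp: quot_def add.assoc)
    then show "z \<in> alex_add (quot D x) (quot D y)"
      unfolding alex_add_def quot_def using free.subspace_0[OF relations_subspace[of D]] by blast
  qed
qed

text \<open>The extra relation in \<open>alex_smul\<close> is what fills up the coset: multiples of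
  the elements of a coset alone can be too few, for instance when \<open>l = 0\<close>.\<close>

lemma alex_smul_quot: "alex_smul D l (quot D x) = quot D (smul l x)"
proof
  show "alex_smul D l (quot D x) \<subseteq> quot D (smul l x)"
  proof
    fix z assume "z \<in> alex_smul D l (quot D x)"
    then obtain r r' where r: "r \<in> relations D" "r' \<in> relations D" "z = smul l (x + r) + r'"
      by (auto simp: alex_smul_def quot_def)
    then have "smul l r + r' \<in> relations D"
      using relations_subspace[of D] by (simp add: free.subspace_add free.subspace_scale)
    moreover have "z = smul l x + (smul l r + r')" using r by (simp add: free.scale_right_distrib add.assoc)
    ultimately show "z \<in> quot D (smul l x)" unfolding quot_def by blast
  qed
  show "quot D (smul l x) \<subseteq> alex_smul D l (quot D x)"
  proof
    fix z assume "z \<in> quot D (smul l x)"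
    then obtain r where r: "r \<in> relations D" "z = smul l (x + 0) + r"
      by (auto simp: quot_def)
    then show "z \<in> alex_smul D l (quot D x)"
      unfolding alex_smul_def quot_def using free.subspace_0[OF relations_subspace[of D]] by blast
  qed
qed


section \<open>Longitudes and linking numbers\<close>

context diagram
begin

section \<open>The map phi on cosets and on meridians\<close>

lemma fst_arc_in_comps: "A \<in> arcs D \<Longrightarrow> fst A \<in> comps D"
  by (auto simp: arcs_def)

lemma
  assumes "c \<in> classical D"
  shows fst_under_arc1: "fst (under_arc1 D c) = fst (snd c)"
    and fst_under_arc2: "fst (under_arc2 D c) = fst (snd c)"
  using in_arc[OF assms] out_arc[OF assms] by (simp_all add: under_arc1_def under_arc2_def)

lemma under_crossings_eq: "{c \<in> classical D. fst (under_arc1 D c) = i} = under_crossings i"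
  by (auto simp: under_crossings_def fst_under_arc1)

text \<open>Both underpassing arcs have the same value \<open>v\<close>. In the first coordinate the
  coefficients of a relator add up to \<open>(1 - t) + t - 1 = 0\<close>; in the others the
  augmentation kills \<open>1 - t\<close> and sends \<open>t\<close> to 1, so the two copies of
  \<open>v\<close> cancel.\<close>

lemma phi_free_relation:
  assumes "r \<in> relations D"
  shows "phi_free E r = 0"
proof -
  obtain y where y: "Poly_Mapping.keys y \<subseteq> classical D" "r = rho D y"
    using assms by (auto simp: relations_def free_module_def)
  \<comment> \<open>Here \<open>u\<close> stands for the value of the overpassing arc and
    \<open>v\<close> for the common value of the underpassing ones.\<close>
  have "target_smul (1 - lt) u + target_smul lt v - v = 0"
    if "fst u = fst v" "fst v = 1" for u v
    using that by (intro prod_eqI poly_mapping_eqI)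
      (simp_all add: fst_target_smul lookup_snd_target_smul lookup_add lookup_minus algebra_simps)
  then have "phi_free E (smul (1 - lt) (gen (over_arc D c)) + smul lt (gen (under_arc1 D c)) - gen (under_arc2 D c)) = 0"
    if "c \<in> classical D" for c
    using that fst_under_arc1 fst_under_arc2
    by (simp add: phi.add phi.diff phi.scale comp_value_def)
  then show ?thesis
    using y by (auto simp: rho_def phi.sum phi.scale intro!: sum.neutral)
qed

lemma phi_quot: "phi D (quot D x) = phi_free D x"
proof -
  have "phi_free D (x + r) = phi_free D x" if "r \<in> relations D" for r
    using that phi_free_relation by (simp add: phi.add)
  moreover have "relations D \<noteq> {}" using free.subspace_0[OF relations_subspace] by blast
  ultimately have "phi_free D ` quot D x = {phi_free D x}"
    unfolding quot_def by (auto simp: image_image)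
  then show ?thesis by (simp add: phi_def)
qed

lemma quot_gen_meridian:
  assumes "a \<in> arcs D"
  shows "quot D (gen a) \<in> meridian_set D (fst a)"
  using assms by (auto simp: meridian_set_def alex_carrier_def phi_quot intro: gen_in_free_module)

lemma phi_meridian:
  assumes "X \<in> meridian_set D i" "i \<in> comps D"
  shows "phi D X = comp_value i"
proof -
  obtain a where "a \<in> arcs D" "fst a = i" using ex_arc[OF assms(2)] .
  then show ?thesis using assms(1) by (auto simp: meridian_set_def phi_quot)
qed

text \<open>Writing a sign as \<open>1 + 2e\<close> with \<open>e \<in> {0, -1}\<close> reduces the claim to signs 1; there the sum is twice the
  sum of the incoming arcs, because incoming and outgoing arcs are the same arcs.\<close>

lemma ex_half:
  obtains h where "h \<in> free_module (arcs D)"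
    "h + h = (\<Sum>c\<in>under_crossings i. smul (of_int (writhe D c)) (gen (under_arc1 D c) + gen (under_arc2 D c)))"
proof -
  define g where "g c = gen (in_arc D c) + gen (out_arc D c)" for c
  define e where "e c = (if right_to_left D c then 0 else - 1 :: laurent)" for c
  let ?C = "under_crossings i"
  define h where "h = (\<Sum>c\<in>?C. gen (in_arc D c)) + (\<Sum>c\<in>?C. smul (e c) (g c))"
  have sub: "?C \<subseteq> classical D" by (auto simp: under_crossings_def)
  have "(\<Sum>c\<in>?C. gen (out_arc D c)) = (\<Sum>a\<in>out_arc D ` ?C. gen a)"
    by (simp add: sum.reindex[OF inj_on_subset[OF inj_on_out_arc sub]])
  also have "\<dots> = (\<Sum>c\<in>?C. gen (in_arc D c))"
    unfolding out_arc_image_eq by (simp add: sum.reindex[OF inj_on_subset[OF inj_on_in_arc sub]])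
  finally have "(\<Sum>c\<in>?C. g c) = (\<Sum>c\<in>?C. gen (in_arc D c)) + (\<Sum>c\<in>?C. gen (in_arc D c))"
    by (simp add: g_def sum.distrib)
  then have "h + h = (\<Sum>c\<in>?C. g c) + ((\<Sum>c\<in>?C. smul (e c) (g c)) + (\<Sum>c\<in>?C. smul (e c) (g c)))"
    unfolding h_def by (simp add: algebra_simps)
  also have "\<dots> = (\<Sum>c\<in>?C. smul (1 + (e c + e c)) (g c))"
    by (simp only: sum.distrib[symmetric] free.scale_left_distrib free.scale_one)
  also have "\<dots> = (\<Sum>c\<in>?C. smul (of_int (writhe D c)) (gen (under_arc1 D c) + gen (under_arc2 D c)))"
    by (intro sum.cong refl) (simp add: e_def g_def writhe_def under_arc1_def under_arc2_def add.commute)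
  finally have hh: "h + h = \<dots>" .
  have "h \<in> free_module (arcs D)"
    unfolding h_def g_def using sub in_arc_in_arcs out_arc_in_arcs
    by (intro free.subspace_add free.subspace_sum free.subspace_scale free_module_subspace gen_in_free_module) auto
  then show ?thesis using hh that by blast
qed

text \<open>A lift of the longitude to the free module, where \<open>phi_free\<close> can be
  evaluated termwise.\<close>

definition longitude_rep :: "nat \<Rightarrow> arc \<Rightarrow>\<^sub>0 laurent" where
  "longitude_rep i =
     (\<Sum>c\<in>under_crossings i. smul (of_int (writhe D c)) (gen (over_arc D c)))
     - half (\<Sum>c\<in>under_crossings i. smul (of_int (writhe D c)) (gen (under_arc1 D c) + gen (under_arc2 D c)))"

lemma longitude_eq: "longitude D i = quot D (longitude_rep i)"
  by (simp add: longitude_def longitude_rep_def under_crossings_eq Let_def)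

lemma longitude_rep_in_free_module: "longitude_rep i \<in> free_module (arcs D)"
proof -
  obtain h where h: "h \<in> free_module (arcs D)"
    "h + h = (\<Sum>c\<in>under_crossings i. smul (of_int (writhe D c)) (gen (under_arc1 D c) + gen (under_arc2 D c)))"
    by (rule ex_half)
  have "longitude_rep i = (\<Sum>c\<in>under_crossings i. smul (of_int (writhe D c)) (gen (over_arc D c))) - h"
    unfolding longitude_rep_def half_eqI[OF h(2)] ..
  also have "\<dots> \<in> free_module (arcs D)"
    using over_arc_in_arcs h(1)
    by (intro free.subspace_diff free.subspace_sum free.subspace_scale free_module_subspace gen_in_free_module)
       (auto simp: under_crossings_def)
  finally show ?thesis .
qed

text \<open>Coordinate \<open>j\<close> counts arcs of component \<open>j\<close>, weighted by the
  augmentations of their coefficients. The overpassing arcs give the linking number. The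
  underpassing arcs all lie in component \<open>i\<close>, so the halved sum contributes the total
  writhe if \<open>j = i\<close> and nothing otherwise.\<close>

lemma lookup_phi_longitude_rep:
  assumes "j \<noteq> 1"
  shows "Poly_Mapping.lookup (snd (phi_free D (longitude_rep i))) j =
    linking_number D j i - (if j = i then \<Sum>c\<in>under_crossings i. writhe D c else 0)"
proof -
  let ?C = "under_crossings i"
  define v where "v x = Poly_Mapping.lookup (snd (phi_free D x)) j" for x
  have v_add: "v (x + y) = v x + v y" for x y by (simp add: v_def phi.add lookup_add)
  have v_diff: "v (x - y) = v x - v y" for x y by (simp add: v_def phi.diff lookup_minus)
  have v_smul: "v (smul l x) = augmentation l * v x" for l x
    by (simp add: v_def phi.scale lookup_snd_target_smul)
  have v_sum: "v (sum f S) = (\<Sum>c\<in>S. v (f c))" for f :: "crossing \<Rightarrow> _" and S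
    by (induction S rule: infinite_finite_induct) (simp_all add: v_add, simp_all add: v_def phi.zero)
  have v_gen: "v (gen a) = of_bool (fst a = j)" for a
    using assms by (simp add: v_def comp_value_def lookup_single when_def)
  obtain h where h: "h + h = (\<Sum>c\<in>?C. smul (of_int (writhe D c)) (gen (under_arc1 D c) + gen (under_arc2 D c)))"
    by (rule ex_half)
  \<comment> \<open>Only the double of \<open>h\<close> is known, so additivity is used to evaluate
    \<open>h + h\<close>, and the factor 2 is cancelled in the integers.\<close>
  have "v h + v h = (\<Sum>c\<in>?C. writhe D c * (of_bool (i = j) + of_bool (i = j)))"
    unfolding v_add[symmetric] h v_sum
    by (intro sum.cong refl)
      (auto simp: v_smul v_add v_gen under_crossings_def fst_under_arc1 fst_under_arc2)
  also have "\<dots> = 2 * (if j = i then \<Sum>c\<in>?C. writhe D c else 0)"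
    by (auto simp: sum_distrib_left mult.commute)
  finally have vh: "v h = (if j = i then \<Sum>c\<in>?C. writhe D c else 0)" by simp
  have "v (\<Sum>c\<in>?C. smul (of_int (writhe D c)) (gen (over_arc D c))) =
      (\<Sum>c\<in>?C. if fst (over_arc D c) = j then writhe D c else 0)"
    unfolding v_sum by (intro sum.cong) (auto simp: v_smul v_gen)
  also have "\<dots> = (\<Sum>c\<in>{c \<in> ?C. fst (over_arc D c) = j}. writhe D c)"
    by (simp add: sum.If_cases finite_under_crossings Int_def conj_commute)
  also have "{c \<in> ?C. fst (over_arc D c) = j} =
      {c \<in> classical D. fst (over_arc D c) = j \<and> fst (under_arc1 D c) = i}"
    using under_crossings_eq[of i] by auto
  finally have "v (\<Sum>c\<in>?C. smul (of_int (writhe D c)) (gen (over_arc D c))) = linking_number D j i"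
    by (simp add: linking_number_def)
  then show ?thesis
    unfolding v_def[symmetric] longitude_rep_def half_eqI[OF h] v_diff vh by simp
qed

text \<open>The underpasses of component \<open>i\<close> are grouped by the component that passes
  over; the term \<open>j = i\<close> collects the self-crossings.\<close>

lemma sum_linking_number:
  "(\<Sum>j\<in>comps D. linking_number D j i) = (\<Sum>c\<in>under_crossings i. writhe D c)"
proof -
  have "linking_number D j i = (\<Sum>c\<in>{c \<in> under_crossings i. fst (over_arc D c) = j}. writhe D c)" for j
    unfolding linking_number_def under_crossings_eq[symmetric] by (intro sum.cong) auto
  moreover have "(\<lambda>c. fst (over_arc D c)) ` under_crossings i \<subseteq> comps D"
    by (auto simp: under_crossings_def intro: fst_arc_in_comps over_arc_in_arcs)
  ultimately show ?thesis
    using sum.group[OF finite_under_crossings, of "comps D" "\<lambda>c. fst (over_arc D c)" i "writhe D"]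
    by (simp add: comps_def)
qed

text \<open>Component 1 has no coordinate of its own, so its linking number is recovered from the
  total writhe \<open>?W\<close>, which the sum of the other coordinates contains with a minus
  sign.\<close>

lemma linking_number_first:
  assumes "i \<in> comps D" "i \<noteq> 1"
  shows "linking_number D 1 i =
    - (\<Sum>j\<in>comps D - {1}. Poly_Mapping.lookup (snd (phi_free D (longitude_rep i))) j)"
proof -
  let ?W = "\<Sum>c\<in>under_crossings i. writhe D c"
  have fin: "finite (comps D)" and 1: "1 \<in> comps D" using ncomp_pos by (auto simp: comps_def)
  have "(\<Sum>j\<in>comps D - {1}. Poly_Mapping.lookup (snd (phi_free D (longitude_rep i))) j) =
      (\<Sum>j\<in>comps D - {1}. linking_number D j i - (if j = i then ?W else 0))"
    by (intro sum.cong refl lookup_phi_longitude_rep) auto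
  \<comment> \<open>Since \<open>i\<close> is not 1, it is among the summation indices, so
    \<open>?W\<close> is subtracted exactly once.\<close>
  also have "\<dots> = (\<Sum>j\<in>comps D - {1}. linking_number D j i) - ?W"
    using assms fin by (simp add: sum_subtractf)
  also have "(\<Sum>j\<in>comps D - {1}. linking_number D j i) = ?W - linking_number D 1 i"
    using sum.remove[OF fin 1, of "\<lambda>j. linking_number D j i"] sum_linking_number[of i] by simp
  finally show ?thesis by simp
qed

end

section \<open>Isomorphisms commute with phi\<close>

lemma enhanced_iso_phi:
  assumes "virtual_diagram D" "virtual_diagram D'" and f: "enhanced_iso f (M_enr D) (M_enr D')"
    and x: "x \<in> free_module (arcs D)"
  shows "phi D' (f (quot D x)) = phi_free D x"
proof -
  interpret D: diagram D by standard fact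
  interpret D': diagram D' by standard fact
  have bij: "bij_betw f (alex_carrier D) (alex_carrier D')"
    and add: "\<And>X Y. X \<in> alex_carrier D \<Longrightarrow> Y \<in> alex_carrier D \<Longrightarrow> f (alex_add X Y) = alex_add (f X) (f Y)"
    and scale: "\<And>l X. X \<in> alex_carrier D \<Longrightarrow> f (alex_smul D l X) = alex_smul D' l (f X)"
    and mer: "map ((`) f) (map (meridian_set D) [1..<Suc (ncomp D)]) = map (meridian_set D') [1..<Suc (ncomp D')]"
    using f by (simp_all add: enhanced_iso_def M_enr_def)
  from arg_cong[OF mer, of length] have nc: "ncomp D = ncomp D'" by (simp del: upt_Suc)
  \<comment> \<open>Both lists run over the same component indices, so their equality can be read
    off index by index.\<close>
  have mer_i: "f ` meridian_set D i = meridian_set D' i" if "i \<in> comps D" for i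
    using mer that unfolding nc comps_def by (auto simp del: upt_Suc)
  have carrier: "quot D y \<in> alex_carrier D" if "y \<in> free_module (arcs D)" for y
    using that by (simp add: alex_carrier_def)
  have ex: "\<exists>x'. f (quot D y) = quot D' x'" if "y \<in> free_module (arcs D)" for y
    using bij_betw_apply[OF bij carrier[OF that]] by (auto simp: alex_carrier_def)
  \<comment> \<open>The aim is that \<open>u\<close> agrees with \<open>phi_free D\<close>. Since
    \<open>f\<close> is controlled only on the carrier, linearity of \<open>u\<close> is available
    only on \<open>free_module (arcs D)\<close>.\<close>
  define u where "u y = phi D' (f (quot D y))" for y
  have u_add: "u (y + z) = u y + u z" if yz: "y \<in> free_module (arcs D)" "z \<in> free_module (arcs D)" for y z
  proof -
    obtain y' z' where "f (quot D y) = quot D' y'" "f (quot D z) = quot D' z'" using yz ex by meson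
    moreover have "f (quot D (y + z)) = alex_add (f (quot D y)) (f (quot D z))"
      using add carrier that by (simp flip: alex_add_quot)
    ultimately show ?thesis by (simp add: u_def alex_add_quot D'.phi_quot phi.add)
  qed
  have u_smul: "u (smul l y) = target_smul l (u y)" if y: "y \<in> free_module (arcs D)" for l y
  proof -
    obtain y' where "f (quot D y) = quot D' y'" using y ex by meson
    moreover have "f (quot D (smul l y)) = alex_smul D' l (f (quot D y))"
      using scale carrier that by (simp flip: alex_smul_quot)
    ultimately show ?thesis by (simp add: u_def alex_smul_quot D'.phi_quot phi.scale)
  qed
  have u_gen: "u (gen a) = comp_value (fst a)" if a: "a \<in> arcs D" for a
  proof -
    have i: "fst a \<in> comps D" using D.fst_arc_in_comps a by blast
    then have "f (quot D (gen a)) \<in> meridian_set D' (fst a)"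
      using mer_i D.quot_gen_meridian[OF a] by blast
    then show ?thesis using D'.phi_meridian i nc by (simp add: u_def comps_def)
  qed
  \<comment> \<open>Linearity on a submodule is extended to finite combinations by induction,
    keeping all partial sums in \<open>free_module (arcs D)\<close>.\<close>
  have "u (\<Sum>a\<in>S. smul (g a) (gen a)) = (\<Sum>a\<in>S. target_smul (g a) (comp_value (fst a)))"
    if "finite S" "S \<subseteq> arcs D" for S g
    using that
  proof (induction S rule: finite_induct)
    case empty
    show ?case using u_smul[OF free.subspace_0[OF free_module_subspace], of 0] by simp
  next
    case (insert a S)
    then have "gen a \<in> free_module (arcs D)" by (simp add: gen_in_free_module)
    moreover have "(\<Sum>a\<in>S. smul (g a) (gen a)) \<in> free_module (arcs D)"
      using insert.prems
      by (intro free.subspace_sum free.subspace_scale free_module_subspace gen_in_free_module) auto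
    ultimately show ?case
      using insert by (simp add: u_add u_smul u_gen free.subspace_scale[OF free_module_subspace])
  qed
  from this[of "Poly_Mapping.keys x" "Poly_Mapping.lookup x"] x have "u x = phi_free D x"
    by (simp add: free_module_def phi_free_def flip: free_module_expansion)
  then show ?thesis by (simp add: u_def)
qed

theorem theorem7:
  fixes L L' :: "vdiagram set" and D D' :: vdiagram
  assumes "L \<in> virtual_links" and "L' \<in> virtual_links"
    and "D \<in> L" and "D' \<in> L'"
    and "M_enr D \<cong>\<^sub>e\<^sub>n\<^sub>r M_enr D'"
  shows "ncomp D = ncomp D' \<and>
         (\<forall>i\<in>{1..ncomp D}. \<forall>j\<in>{1..ncomp D}. i \<noteq> j \<longrightarrow>
            linking_number D j i = linking_number D' j i)"
proof -
  have vd: "virtual_diagram D" "virtual_diagram D'"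
    using assms(1-4) by (auto simp: virtual_links_def quotient_def diagram_equiv_def)
  interpret D: diagram D by standard fact
  interpret D': diagram D' by standard fact
  obtain f where f: "enhanced_iso f (M_enr D) (M_enr D')"
    using assms(5) by (auto simp: enhanced_isomorphic_def)
  then have lon: "map f (map (longitude D) [1..<Suc (ncomp D)]) = map (longitude D') [1..<Suc (ncomp D')]"
    by (simp add: enhanced_iso_def M_enr_def)
  from arg_cong[OF lon, of length] have nc: "ncomp D = ncomp D'" by (simp del: upt_Suc)
  have phi_eq: "phi_free D (D.longitude_rep i) = phi_free D' (D'.longitude_rep i)" if "i \<in> comps D" for i
  proof -
    have "f (longitude D i) = longitude D' i"
      using lon that unfolding nc comps_def by (auto simp del: upt_Suc)
    then show ?thesis
      using enhanced_iso_phi[OF vd f D.longitude_rep_in_free_module, of i]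
      by (simp add: D.longitude_eq D'.longitude_eq D'.phi_quot)
  qed
  have "linking_number D j i = linking_number D' j i" if "i \<in> comps D" "j \<in> comps D" "i \<noteq> j" for i j
  \<comment> \<open>For \<open>j = 1\<close> the index \<open>i\<close> differs from 1, as
    \<open>linking_number_first\<close> demands; otherwise coordinate \<open>j\<close> is the
    linking number itself, the writhe correction being absent because \<open>i\<close> and
    \<open>j\<close> differ.\<close>
  proof (cases "j = 1")
    case True
    then have "i \<noteq> 1" "i \<in> comps D'" "comps D = comps D'" using that nc by (auto simp: comps_def)
    then show ?thesis
      using D.linking_number_first[of i] D'.linking_number_first[of i] phi_eq[of i] that True by simp
  next
    case False
    then show ?thesis
      using D.lookup_phi_longitude_rep[of j i] D'.lookup_phi_longitude_rep[of j i] phi_eq[of i] that by simp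
  qed
  then show ?thesis using nc by (simp add: comps_def)
qed

end
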